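(* (1) The class of CSA-groups is finitely universally axiomatizable, i.e. it is the class of all groups satisfying a certain finite set of universal first-order sentences in the language of groups. (2) The class of CSA-groups is closed under ultraproducts. (3) The class of CSA-groups is closed under taking subgroups.
   Context: A subgroup $H$ of a group $G$ is conjugately separated (malnormal) if $H\cap H^x=1$ for every $x\in G\setminus H$, where $H^x=x^{-1}Hx$. A group $G$ is a CSA-group if all its maximal abelian subgroups are conjugately separated. *)

theory Defs
  imports "HOL-Algebra.Product_Groups"
begin

section \<open>CSA-groups\<close>

definition conj_set :: "('a, 'm) monoid_scheme \<Rightarrow> 'a set \<Rightarrow> 'a \<Rightarrow> 'a set" where
  "conj_set G H x = (\<lambda>h. inv\<^bsub>G\<^esub> x \<otimes>\<^bsub>G\<^esub> h \<otimes>\<^bsub>G\<^esub> x) ` H"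

definition conjugately_separated :: "'a set \<Rightarrow> ('a, 'm) monoid_scheme \<Rightarrow> bool" where
  "conjugately_separated H G \<longleftrightarrow>
     subgroup H G \<and> (\<forall>x \<in> carrier G - H. H \<inter> conj_set G H x = {\<one>\<^bsub>G\<^esub>})"

definition abelian_subgroup :: "'a set \<Rightarrow> ('a, 'm) monoid_scheme \<Rightarrow> bool" where
  "abelian_subgroup M G \<longleftrightarrow> subgroup M G \<and> comm_group (G\<lparr>carrier := M\<rparr>)"

definition maximal_abelian_subgroup :: "'a set \<Rightarrow> ('a, 'm) monoid_scheme \<Rightarrow> bool" where
  "maximal_abelian_subgroup M G \<longleftrightarrow>
     abelian_subgroup M G \<and> (\<forall>K. abelian_subgroup K G \<and> M \<subseteq> K \<longrightarrow> K = M)"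

definition csa_group :: "('a, 'm) monoid_scheme \<Rightarrow> bool" where
  "csa_group G \<longleftrightarrow>
     group G \<and> (\<forall>M. maximal_abelian_subgroup M G \<longrightarrow> conjugately_separated M G)"


section \<open>First-order logic in the language of groups\<close>

datatype gterm =
    GVar nat
  | GOne
  | GInv gterm
  | GMult gterm gterm

datatype gform =
    GEq gterm gterm
  | GNeg gform
  | GConj gform gform
  | GDisj gform gform
  | GImp gform gform
  | GAll nat gform
  | GEx nat gform

primrec term_val :: "('a, 'm) monoid_scheme \<Rightarrow> (nat \<Rightarrow> 'a) \<Rightarrow> gterm \<Rightarrow> 'a" where
  "term_val G e (GVar n) = e n"
| "term_val G e GOne = \<one>\<^bsub>G\<^esub>"
| "term_val G e (GInv t) = inv\<^bsub>G\<^esub> (term_val G e t)"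
| "term_val G e (GMult s t) = term_val G e s \<otimes>\<^bsub>G\<^esub> term_val G e t"

primrec form_sat :: "('a, 'm) monoid_scheme \<Rightarrow> (nat \<Rightarrow> 'a) \<Rightarrow> gform \<Rightarrow> bool" where
  "form_sat G e (GEq s t) \<longleftrightarrow> term_val G e s = term_val G e t"
| "form_sat G e (GNeg p) \<longleftrightarrow> \<not> form_sat G e p"
| "form_sat G e (GConj p q) \<longleftrightarrow> form_sat G e p \<and> form_sat G e q"
| "form_sat G e (GDisj p q) \<longleftrightarrow> form_sat G e p \<or> form_sat G e q"
| "form_sat G e (GImp p q) \<longleftrightarrow> (form_sat G e p \<longrightarrow> form_sat G e q)"
| "form_sat G e (GAll n p) \<longleftrightarrow> (\<forall>a \<in> carrier G. form_sat G (e(n := a)) p)"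
| "form_sat G e (GEx n p) \<longleftrightarrow> (\<exists>a \<in> carrier G. form_sat G (e(n := a)) p)"

primrec term_vars :: "gterm \<Rightarrow> nat set" where
  "term_vars (GVar n) = {n}"
| "term_vars GOne = {}"
| "term_vars (GInv t) = term_vars t"
| "term_vars (GMult s t) = term_vars s \<union> term_vars t"

primrec free_vars :: "gform \<Rightarrow> nat set" where
  "free_vars (GEq s t) = term_vars s \<union> term_vars t"
| "free_vars (GNeg p) = free_vars p"
| "free_vars (GConj p q) = free_vars p \<union> free_vars q"
| "free_vars (GDisj p q) = free_vars p \<union> free_vars q"
| "free_vars (GImp p q) = free_vars p \<union> free_vars q"
| "free_vars (GAll n p) = free_vars p - {n}"
| "free_vars (GEx n p) = free_vars p - {n}"

primrec quantifier_free :: "gform \<Rightarrow> bool" where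
  "quantifier_free (GEq s t) \<longleftrightarrow> True"
| "quantifier_free (GNeg p) \<longleftrightarrow> quantifier_free p"
| "quantifier_free (GConj p q) \<longleftrightarrow> quantifier_free p \<and> quantifier_free q"
| "quantifier_free (GDisj p q) \<longleftrightarrow> quantifier_free p \<and> quantifier_free q"
| "quantifier_free (GImp p q) \<longleftrightarrow> quantifier_free p \<and> quantifier_free q"
| "quantifier_free (GAll n p) \<longleftrightarrow> False"
| "quantifier_free (GEx n p) \<longleftrightarrow> False"

definition universal_sentence :: "gform \<Rightarrow> bool" where
  "universal_sentence p \<longleftrightarrow>
     free_vars p = {} \<and> (\<exists>ns q. quantifier_free q \<and> p = foldr GAll ns q)"

text \<open>For a sentence the value does not depend on the assignment, and in a group there is
  at least one assignment into the carrier, so quantifying over all of them is harmless.\<close>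

definition models :: "('a, 'm) monoid_scheme \<Rightarrow> gform \<Rightarrow> bool" where
  "models G p \<longleftrightarrow> (\<forall>e. range e \<subseteq> carrier G \<longrightarrow> form_sat G e p)"


section \<open>An explicit axiom system\<close>

text \<open>
  An existential quantifier over sets of sentences, placed inside a theorem about groups over a
  type variable, would let the set of sentences depend on that type. Naming the
  sentences gives one and the same set for groups over every type. In conventional notation:

  \<^item> for all x, y, z: if y is nontrivial, xy = yx and yz = zy, then xz = zx;
  \<^item> for all x, y: if x is nontrivial and commutes with its conjugate by y, then xy = yx.
\<close>

definition GComm :: "gterm \<Rightarrow> gterm \<Rightarrow> gform" where
  "GComm s t = GEq (GMult s t) (GMult t s)"

definition commutation_transitive_sentence :: gform where
  "commutation_transitive_sentence =
     (let x = GVar 0; y = GVar 1; z = GVar 2 in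
      GAll 0 (GAll 1 (GAll 2
        (GImp (GConj (GNeg (GEq y GOne)) (GConj (GComm x y) (GComm y z)))
              (GComm x z)))))"

definition conjugate_commutation_sentence :: gform where
  "conjugate_commutation_sentence =
     (let x = GVar 0; y = GVar 1 in
      GAll 0 (GAll 1
        (GImp (GConj (GNeg (GEq x GOne)) (GComm x (GMult (GMult (GInv y) x) y)))
              (GComm x y))))"

definition csa_axioms :: "gform set" where
  "csa_axioms = {commutation_transitive_sentence, conjugate_commutation_sentence}"


section \<open>Ultraproducts of groups\<close>

definition ultrafilter_on :: "'i set \<Rightarrow> 'i filter \<Rightarrow> bool" where
  "ultrafilter_on I U \<longleftrightarrow>
     U \<noteq> bot \<and> U \<le> principal I \<and>
     (\<forall>P. eventually P U \<or> eventually (\<lambda>i. \<not> P i) U)"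

definition ultra_rel ::
  "'i set \<Rightarrow> 'i filter \<Rightarrow> ('i \<Rightarrow> ('a, 'm) monoid_scheme) \<Rightarrow> (('i \<Rightarrow> 'a) \<times> ('i \<Rightarrow> 'a)) set" where
  "ultra_rel I U G =
     {(f, g). f \<in> carrier (product_group I G) \<and> g \<in> carrier (product_group I G) \<and>
              eventually (\<lambda>i. f i = g i) U}"

text \<open>The union in the multiplication ranges over all choices of representatives; they all
  contribute the same class.\<close>

definition ultraproduct ::
  "'i set \<Rightarrow> 'i filter \<Rightarrow> ('i \<Rightarrow> ('a, 'm) monoid_scheme) \<Rightarrow> ('i \<Rightarrow> 'a) set monoid" where
  "ultraproduct I U G =
     \<lparr>carrier = carrier (product_group I G) // ultra_rel I U G,
      monoid.mult = (\<lambda>A B. \<Union>f\<in>A. \<Union>g\<in>B. ultra_rel I U G `` {f \<otimes>\<^bsub>product_group I G\<^esub> g}),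
      one = ultra_rel I U G `` {\<one>\<^bsub>product_group I G\<^esub>}\<rparr>"

end

theory Submission
  imports Defs
begin

text \<open>
  By Zorn, a commuting pair lies in a maximal abelian subgroup; if that subgroup is conjugately
  separated, both axioms follow. Conversely, commutation transitivity makes the centralizer of a
  nontrivial element abelian, so a maximal abelian subgroup is the centralizer of each of its
  nontrivial elements, and the second axiom says that these centralizers are conjugately separated.
  Universal sentences pass to subgroups. In an ultraproduct, both axioms are checked
  coordinatewise, the ultrafilter turning the negated equation in the premise into
  "almost everywhere different".
\<close>

section \<open>Commuting sets and maximal abelian subgroups\<close>

text \<open>With this form, \<open>S \<subseteq> centralizer_of G S\<close> says in one inclusion
  that \<open>S\<close> lies in the carrier and that its elements commute pairwise.\<close>

definition centralizer_of :: "('a, 'm) monoid_scheme \<Rightarrow> 'a set \<Rightarrow> 'a set" where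
  "centralizer_of G S = {x \<in> carrier G. \<forall>s\<in>S. x \<otimes>\<^bsub>G\<^esub> s = s \<otimes>\<^bsub>G\<^esub> x}"

context group
begin

lemma subgroup_centralizer_of:
  assumes "S \<subseteq> carrier G"
  shows "subgroup (centralizer_of G S) G"
proof (rule subgroupI)
  show "centralizer_of G S \<subseteq> carrier G"
    by (auto simp: centralizer_of_def)
  have "\<one> \<in> centralizer_of G S"
    using assms by (auto simp: centralizer_of_def)
  then show "centralizer_of G S \<noteq> {}" by auto
next
  fix a assume a: "a \<in> centralizer_of G S"
  have "inv a \<otimes> s = s \<otimes> inv a" if s: "s \<in> S" for s
  proof -
    have ac: "a \<in> carrier G" and sc: "s \<in> carrier G" and as: "a \<otimes> s = s \<otimes> a"
      using a s assms by (auto simp: centralizer_of_def)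
    \<comment> \<open>Appending \<open>a\<close> and its inverse creates
      \<open>s \<otimes> a\<close>; replacing it by \<open>a \<otimes> s\<close> lets the leading
      inverse cancel.\<close>
    have "inv a \<otimes> s = inv a \<otimes> (s \<otimes> a) \<otimes> inv a"
      using ac sc by (simp add: m_assoc)
    also have "\<dots> = s \<otimes> inv a"
      using ac sc by (simp add: m_assoc[symmetric] as[symmetric])
    finally show ?thesis .
  qed
  then show "inv a \<in> centralizer_of G S"
    using a by (auto simp: centralizer_of_def)
next
  fix a b assume a: "a \<in> centralizer_of G S" and b: "b \<in> centralizer_of G S"
  have "a \<otimes> b \<otimes> s = s \<otimes> (a \<otimes> b)" if s: "s \<in> S" for s
  proof -
    have c: "a \<in> carrier G" "b \<in> carrier G" "s \<in> carrier G"
      and as: "a \<otimes> s = s \<otimes> a" and bs: "b \<otimes> s = s \<otimes> b"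
      using a b s assms by (auto simp: centralizer_of_def)
    have "a \<otimes> b \<otimes> s = a \<otimes> s \<otimes> b"
      using c by (simp add: m_assoc bs)
    then show ?thesis
      using c by (simp add: m_assoc as)
  qed
  then show "a \<otimes> b \<in> centralizer_of G S"
    using a b by (auto simp: centralizer_of_def)
qed

lemma abelian_subgroup_iff:
  "abelian_subgroup M G \<longleftrightarrow> subgroup M G \<and> (\<forall>x\<in>M. \<forall>y\<in>M. x \<otimes> y = y \<otimes> x)"
proof -
  have "comm_group (G\<lparr>carrier := M\<rparr>) \<longleftrightarrow> (\<forall>x\<in>M. \<forall>y\<in>M. x \<otimes> y = y \<otimes> x)"
    if M: "subgroup M G"
  proof
    assume "comm_group (G\<lparr>carrier := M\<rparr>)"
    then interpret comm_group "G\<lparr>carrier := M\<rparr>" .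
    show "\<forall>x\<in>M. \<forall>y\<in>M. x \<otimes> y = y \<otimes> x"
      using m_comm by simp
  next
    assume "\<forall>x\<in>M. \<forall>y\<in>M. x \<otimes> y = y \<otimes> x"
    then show "comm_group (G\<lparr>carrier := M\<rparr>)"
      using group.group_comm_groupI[OF subgroup.subgroup_is_group[OF M is_group]] by simp
  qed
  then show ?thesis
    by (auto simp: abelian_subgroup_def)
qed

text \<open>A maximal set of pairwise commuting elements is its own centralizer, hence a subgroup.\<close>

lemma commuting_pair_in_maximal_abelian_subgroup:
  assumes "a \<in> carrier G" "b \<in> carrier G" "a \<otimes> b = b \<otimes> a"
  obtains M where "maximal_abelian_subgroup M G" "a \<in> M" "b \<in> M"
proof -
  \<comment> \<open>Zorn is applied to commuting sets instead of abelian subgroups, so that a union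
    of a chain needs no closure argument. Requiring \<open>a\<close> and \<open>b\<close> in every
    member puts them into the maximal one.\<close>
  define \<C> where "\<C> = {S. {a, b} \<subseteq> S \<and> S \<subseteq> centralizer_of G S}"
  have comm: "x \<otimes> y = y \<otimes> x" if "S \<in> \<C>" "x \<in> S" "y \<in> S" for S x y
    using that by (auto simp: \<C>_def centralizer_of_def)
  have "{a, b} \<in> \<C>"
    using assms by (auto simp: \<C>_def centralizer_of_def)
  moreover have "\<Union>\<D> \<in> \<C>" if "\<D> \<noteq> {}" and chain: "subset.chain \<C> \<D>" for \<D>
  proof -
    have sub: "\<D> \<subseteq> \<C>" and lin: "\<And>S T. S \<in> \<D> \<Longrightarrow> T \<in> \<D> \<Longrightarrow> S \<subseteq> T \<or> T \<subseteq> S"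
      using chain by (auto simp: subset_chain_def)
    \<comment> \<open>Two members of a chain are comparable, so both elements lie in the larger
      one.\<close>
    have "x \<otimes> y = y \<otimes> x" if "S \<in> \<D>" "T \<in> \<D>" "x \<in> S" "y \<in> T" for S T x y
      using lin[OF that(1,2)] comm[of S] comm[of T] sub that by blast
    moreover have "\<Union>\<D> \<subseteq> carrier G" and "{a, b} \<subseteq> \<Union>\<D>"
      using sub \<open>\<D> \<noteq> {}\<close> by (auto simp: \<C>_def centralizer_of_def)
    ultimately show ?thesis
      unfolding \<C>_def centralizer_of_def by blast
  qed
  ultimately obtain M where M: "M \<in> \<C>" and max: "\<And>S. S \<in> \<C> \<Longrightarrow> M \<subseteq> S \<Longrightarrow> S = M"
    using subset_Zorn_nonempty[of \<C>] by blast
  have ab: "a \<in> M" "b \<in> M" and MC: "M \<subseteq> centralizer_of G M"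
    using M by (auto simp: \<C>_def)
  \<comment> \<open>Adjoining an element that centralizes \<open>M\<close> leaves a commuting set,
    which by maximality is \<open>M\<close> itself.\<close>
  have "x \<in> M" if "x \<in> centralizer_of G M" for x
  proof -
    have "insert x M \<in> \<C>"
      using M that by (auto simp: \<C>_def centralizer_of_def)
    then show ?thesis
      using max[of "insert x M"] by blast
  qed
  with MC have eq: "centralizer_of G M = M" by blast
  have "M \<subseteq> carrier G"
    using MC by (auto simp: centralizer_of_def)
  then have "subgroup M G"
    using subgroup_centralizer_of[of M] eq by simp
  then have "abelian_subgroup M G"
    using comm[OF M] by (auto simp: abelian_subgroup_iff)
  \<comment> \<open>An abelian subgroup above \<open>M\<close> is itself in \<open>\<C>\<close>, so
    maximality among commuting sets gives maximality among abelian subgroups.\<close>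
  moreover have "K = M" if "abelian_subgroup K G" "M \<subseteq> K" for K
  proof (rule max[OF _ \<open>M \<subseteq> K\<close>])
    have "K \<subseteq> carrier G"
      using that subgroup.subset by (auto simp: abelian_subgroup_iff)
    then show "K \<in> \<C>"
      using that ab by (auto simp: \<C>_def centralizer_of_def abelian_subgroup_iff)
  qed
  ultimately show thesis
    using that ab by (auto simp: maximal_abelian_subgroup_def)
qed

end

section \<open>Elementwise form of the axioms\<close>

definition commutation_transitive :: "('a, 'm) monoid_scheme \<Rightarrow> bool" where
  "commutation_transitive G \<longleftrightarrow>
     (\<forall>x\<in>carrier G. \<forall>y\<in>carrier G. \<forall>z\<in>carrier G.
        y \<noteq> \<one>\<^bsub>G\<^esub> \<and> x \<otimes>\<^bsub>G\<^esub> y = y \<otimes>\<^bsub>G\<^esub> x \<and> y \<otimes>\<^bsub>G\<^esub> z = z \<otimes>\<^bsub>G\<^esub> y \<longrightarrow>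
        x \<otimes>\<^bsub>G\<^esub> z = z \<otimes>\<^bsub>G\<^esub> x)"

definition conjugate_commutation :: "('a, 'm) monoid_scheme \<Rightarrow> bool" where
  "conjugate_commutation G \<longleftrightarrow>
     (\<forall>x\<in>carrier G. \<forall>y\<in>carrier G.
        x \<noteq> \<one>\<^bsub>G\<^esub> \<and>
        x \<otimes>\<^bsub>G\<^esub> (inv\<^bsub>G\<^esub> y \<otimes>\<^bsub>G\<^esub> x \<otimes>\<^bsub>G\<^esub> y) = (inv\<^bsub>G\<^esub> y \<otimes>\<^bsub>G\<^esub> x \<otimes>\<^bsub>G\<^esub> y) \<otimes>\<^bsub>G\<^esub> x \<longrightarrow>
        x \<otimes>\<^bsub>G\<^esub> y = y \<otimes>\<^bsub>G\<^esub> x)"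

lemma models_csa_axioms_iff:
  assumes "group G"
  shows "(\<forall>p\<in>csa_axioms. models G p) \<longleftrightarrow> commutation_transitive G \<and> conjugate_commutation G"
proof -
  interpret group G by fact
  have "range (\<lambda>_::nat. \<one>\<^bsub>G\<^esub>) \<subseteq> carrier G" by auto
  then have "\<exists>e :: nat \<Rightarrow> _. range e \<subseteq> carrier G" by blast
  then show ?thesis
    by (simp add: csa_axioms_def models_def commutation_transitive_sentence_def GComm_def Let_def
        conjugate_commutation_sentence_def commutation_transitive_def conjugate_commutation_def)
qed

lemma universal_sentence_csa_axioms:
  assumes "p \<in> csa_axioms"
  shows "universal_sentence p"
proof -
  have "\<exists>ns q. quantifier_free q \<and> commutation_transitive_sentence = foldr GAll ns q"
    \<comment> \<open>The list is the quantifier prefix, outermost variable first; the equation then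
      determines the matrix \<open>q\<close>.\<close>
    by (intro exI[of _ "[0, 1, 2]"])
       (auto simp: commutation_transitive_sentence_def GComm_def Let_def)
  moreover have "\<exists>ns q. quantifier_free q \<and> conjugate_commutation_sentence = foldr GAll ns q"
    by (intro exI[of _ "[0, 1]"])
       (auto simp: conjugate_commutation_sentence_def GComm_def Let_def)
  moreover have "free_vars commutation_transitive_sentence = {}"
    "free_vars conjugate_commutation_sentence = {}"
    by (auto simp: commutation_transitive_sentence_def conjugate_commutation_sentence_def
        GComm_def Let_def)
  ultimately show ?thesis
    using assms by (auto simp: csa_axioms_def universal_sentence_def)
qed

section \<open>Conjugate separation and the two elementwise axioms\<close>

context group
begin

text \<open>Otherwise the conjugate of \<open>h\<close> lies in the trivial intersection of
  \<open>M\<close> with its conjugate by \<open>x\<close>; it is then \<open>\<one>\<close>, and so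
  is \<open>h\<close>.\<close>

lemma conjugately_separatedD:
  assumes "conjugately_separated M G" "x \<in> carrier G" "h \<in> M"
    "inv x \<otimes> h \<otimes> x \<in> M" "h \<noteq> \<one>"
  shows "x \<in> M"
proof (rule ccontr)
  assume "x \<notin> M"
  have "h \<in> carrier G"
    using assms subgroup.mem_carrier by (auto simp: conjugately_separated_def)
  have "inv x \<otimes> h \<otimes> x \<in> M \<inter> conj_set G M x"
    using assms by (auto simp: conj_set_def)
  then have "inv x \<otimes> h \<otimes> x = \<one>"
    using assms \<open>x \<notin> M\<close> by (auto simp: conjugately_separated_def)
  then have "x = h \<otimes> x"
    using assms(2) \<open>h \<in> carrier G\<close> by (simp add: m_assoc inv_solve_left')
  then have "h = \<one>"
    using assms(2) \<open>h \<in> carrier G\<close> by (simp add: r_cancel_one')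
  with assms show False by simp
qed

text \<open>Some maximal abelian \<open>M\<close> contains \<open>x\<close> and \<open>y\<close>.
  Conjugation by \<open>z\<close> fixes the nontrivial \<open>y\<close>, so separation forces
  \<open>z\<close> into the same \<open>M\<close>.\<close>

lemma csa_group_imp_commutation_transitive:
  assumes "csa_group G"
  shows "commutation_transitive G"
  unfolding commutation_transitive_def
proof (intro ballI impI, elim conjE)
  fix x y z
  assume c: "x \<in> carrier G" "y \<in> carrier G" "z \<in> carrier G"
    and y: "y \<noteq> \<one>" and xy: "x \<otimes> y = y \<otimes> x" and yz: "y \<otimes> z = z \<otimes> y"
  obtain M where M: "maximal_abelian_subgroup M G" "x \<in> M" "y \<in> M"
    using commuting_pair_in_maximal_abelian_subgroup[OF c(1,2) xy] by blast
  have "inv z \<otimes> y \<otimes> z = y"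
    using c by (simp add: m_assoc yz inv_solve_left')
  then have "z \<in> M"
    using conjugately_separatedD[of M z y] assms M c y by (auto simp: csa_group_def)
  with M show "x \<otimes> z = z \<otimes> x"
    by (auto simp: maximal_abelian_subgroup_def abelian_subgroup_iff)
qed

text \<open>A maximal abelian subgroup containing both \<open>x\<close> and its conjugate by
  \<open>y\<close> must contain \<open>y\<close>, by separation applied to
  \<open>h = x\<close>.\<close>

lemma csa_group_imp_conjugate_commutation:
  assumes "csa_group G"
  shows "conjugate_commutation G"
  unfolding conjugate_commutation_def
proof (intro ballI impI, elim conjE)
  fix x y
  assume c: "x \<in> carrier G" "y \<in> carrier G" and x: "x \<noteq> \<one>"
    and comm: "x \<otimes> (inv y \<otimes> x \<otimes> y) = (inv y \<otimes> x \<otimes> y) \<otimes> x"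
  obtain M where M: "maximal_abelian_subgroup M G" "x \<in> M" "inv y \<otimes> x \<otimes> y \<in> M"
    using commuting_pair_in_maximal_abelian_subgroup[OF c(1) _ comm] c by auto
  then have "y \<in> M"
    using conjugately_separatedD[of M y x] assms c x by (auto simp: csa_group_def)
  with M show "x \<otimes> y = y \<otimes> x"
    by (auto simp: maximal_abelian_subgroup_def abelian_subgroup_iff)
qed

text \<open>With the nontrivial \<open>k\<close> as middle element, transitivity makes the
  centralizer of \<open>k\<close> abelian. It contains the abelian \<open>M\<close>, so maximality
  gives equality.\<close>

lemma maximal_abelian_eq_centralizer_of:
  assumes ct: "commutation_transitive G" and M: "maximal_abelian_subgroup M G"
    and k: "k \<in> M" "k \<noteq> \<one>"
  shows "M = centralizer_of G {k}"
proof -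
  have sub: "subgroup M G" and comm: "\<And>x y. x \<in> M \<Longrightarrow> y \<in> M \<Longrightarrow> x \<otimes> y = y \<otimes> x"
    using M by (auto simp: maximal_abelian_subgroup_def abelian_subgroup_iff)
  have carr: "M \<subseteq> carrier G"
    using sub by (rule subgroup.subset)
  have "subgroup (centralizer_of G {k}) G"
    using carr k by (intro subgroup_centralizer_of) auto
  moreover have "x \<otimes> y = y \<otimes> x"
    if "x \<in> centralizer_of G {k}" "y \<in> centralizer_of G {k}" for x y
  proof -
    have "x \<in> carrier G" "y \<in> carrier G" "x \<otimes> k = k \<otimes> x" "k \<otimes> y = y \<otimes> k" "k \<in> carrier G"
      using that k carr by (auto simp: centralizer_of_def)
    with ct k show ?thesis
      unfolding commutation_transitive_def by blast
  qed
  ultimately have "abelian_subgroup (centralizer_of G {k}) G"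
    by (simp add: abelian_subgroup_iff)
  moreover have "M \<subseteq> centralizer_of G {k}"
    using carr comm k by (auto simp: centralizer_of_def)
  ultimately show ?thesis
    using M by (auto simp: maximal_abelian_subgroup_def)
qed

lemma csa_groupI:
  assumes ct: "commutation_transitive G" and cc: "conjugate_commutation G"
  shows "csa_group G"
  unfolding csa_group_def
proof (intro conjI allI impI)
  show "group G" by (rule is_group)
next
  fix M assume M: "maximal_abelian_subgroup M G"
  then have sub: "subgroup M G" and comm: "\<And>x y. x \<in> M \<Longrightarrow> y \<in> M \<Longrightarrow> x \<otimes> y = y \<otimes> x"
    by (auto simp: maximal_abelian_subgroup_def abelian_subgroup_iff)
  have "M \<inter> conj_set G M x = {\<one>}" if x: "x \<in> carrier G" "x \<notin> M" for x
  proof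
    have "\<one> = inv x \<otimes> \<one> \<otimes> x"
      using x by simp
    then show "{\<one>} \<subseteq> M \<inter> conj_set G M x"
      using subgroup.one_closed[OF sub] by (auto simp: conj_set_def image_iff)
  next
    show "M \<inter> conj_set G M x \<subseteq> {\<one>}"
    proof
      fix h assume "h \<in> M \<inter> conj_set G M x"
      then obtain k where k: "k \<in> M" and h: "h \<in> M" "h = inv x \<otimes> k \<otimes> x"
        by (auto simp: conj_set_def)
      have kc: "k \<in> carrier G"
        using sub k by (rule subgroup.mem_carrier)
      have "k = \<one>"
      proof (rule ccontr)
        assume "k \<noteq> \<one>"
        \<comment> \<open>Here \<open>h\<close> is the conjugate of \<open>k\<close> by
          \<open>x\<close>, and both lie in the abelian \<open>M\<close>. The second axiom therefore
          makes \<open>x\<close> centralize \<open>k\<close>, that is, puts \<open>x\<close> into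
          \<open>M\<close>.\<close>
        moreover have "k \<otimes> h = h \<otimes> k"
          using comm k h(1) .
        ultimately have "k \<otimes> x = x \<otimes> k"
          using cc kc x(1) h(2) unfolding conjugate_commutation_def by blast
        then have "x \<in> centralizer_of G {k}"
          using x(1) by (simp add: centralizer_of_def)
        with maximal_abelian_eq_centralizer_of[OF ct M k \<open>k \<noteq> \<one>\<close>] x(2) show False
          by simp
      qed
      with h x(1) show "h \<in> {\<one>}" by simp
    qed
  qed
  with sub show "conjugately_separated M G"
    by (auto simp: conjugately_separated_def)
qed

end

lemma csa_group_iff:
  "csa_group G \<longleftrightarrow> group G \<and> commutation_transitive G \<and> conjugate_commutation G"
  using group.csa_groupI group.csa_group_imp_commutation_transitive
    group.csa_group_imp_conjugate_commutation csa_group_def by metis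

section \<open>Subgroups and ultraproducts\<close>

lemma csa_group_subgroup:
  assumes "csa_group G" and H: "subgroup H G"
  shows "csa_group (G\<lparr>carrier := H\<rparr>)"
proof -
  have G: "group G" and ct: "commutation_transitive G" and cc: "conjugate_commutation G"
    using assms(1) by (simp_all add: csa_group_iff)
  have "group (G\<lparr>carrier := H\<rparr>)"
    using H G by (rule subgroup.subgroup_is_group)
  moreover have "commutation_transitive (G\<lparr>carrier := H\<rparr>)"
    using ct subgroup.subset[OF H] unfolding commutation_transitive_def by (simp add: subset_iff) blast
  \<comment> \<open>The inverse depends on the carrier of the record;
    \<open>m_inv_consistent\<close> identifies the inverse taken in \<open>H\<close> with the one
    taken in \<open>G\<close>.\<close>
  moreover have "conjugate_commutation (G\<lparr>carrier := H\<rparr>)"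
    using cc subgroup.subset[OF H] group.m_inv_consistent[OF G H]
    unfolding conjugate_commutation_def by (simp add: subset_iff) blast
  ultimately show ?thesis
    by (simp add: csa_group_iff)
qed

section \<open>The ultraproduct as a quotient group of the direct product\<close>

locale group_ultraproduct =
  fixes I :: "'i set" and U :: "'i filter" and G :: "'i \<Rightarrow> ('a, 'm) monoid_scheme"
  assumes ultrafilter: "ultrafilter_on I U"
    and groups: "i \<in> I \<Longrightarrow> group (G i)"
begin

abbreviation P :: "('i \<Rightarrow> 'a) monoid" where
  "P \<equiv> product_group I G"

abbreviation cls :: "('i \<Rightarrow> 'a) \<Rightarrow> ('i \<Rightarrow> 'a) set" where
  "cls f \<equiv> ultra_rel I U G `` {f}"

text \<open>The operations of \<open>product_group\<close> are coordinatewise only on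
  \<open>I\<close> and the factors are groups only there; this fact restricts every argument about
  almost all indices to \<open>I\<close>.\<close>

lemma eventually_mem: "eventually (\<lambda>i. i \<in> I) U"
  using ultrafilter le_principal unfolding ultrafilter_on_def by blast

text \<open>Properness of the filter excludes that \<open>Q\<close> and its negation both hold
  eventually; the ultrafilter dichotomy provides one of them.\<close>

lemma eventually_not_iff: "eventually (\<lambda>i. \<not> Q i) U \<longleftrightarrow> \<not> eventually Q U"
proof
  assume "eventually (\<lambda>i. \<not> Q i) U"
  moreover have "\<not> eventually (\<lambda>_. False) U"
    using ultrafilter by (auto simp: ultrafilter_on_def trivial_limit_def)
  ultimately show "\<not> eventually Q U"
    using eventually_elim2[of "\<lambda>i. \<not> Q i" U Q "\<lambda>_. False"] by blast
qed (use ultrafilter in \<open>auto simp: ultrafilter_on_def\<close>)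

sublocale P: group P
  using groups by simp

lemma equiv_ultra_rel: "equiv (carrier P) (ultra_rel I U G)"
proof (rule equivI)
  show "ultra_rel I U G \<subseteq> carrier P \<times> carrier P" "refl_on (carrier P) (ultra_rel I U G)"
    by (auto simp: ultra_rel_def refl_on_def)
  show "sym (ultra_rel I U G)"
    by (auto simp: ultra_rel_def sym_def eq_commute)
  show "trans (ultra_rel I U G)"
    unfolding trans_def ultra_rel_def by (auto elim: eventually_elim2)
qed

lemma cls_eq_iff:
  "f \<in> carrier P \<Longrightarrow> g \<in> carrier P \<Longrightarrow> cls f = cls g \<longleftrightarrow> eventually (\<lambda>i. f i = g i) U"
  by (subst eq_equiv_class_iff[OF equiv_ultra_rel]) (auto simp: ultra_rel_def)

text \<open>Eventual equality is a congruence: two changes of representative agree simultaneously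
  almost everywhere. The union over representatives thus collapses to a single class.\<close>

lemma mult_cls:
  assumes "f \<in> carrier P" "g \<in> carrier P"
  shows "cls f \<otimes>\<^bsub>ultraproduct I U G\<^esub> cls g = cls (f \<otimes>\<^bsub>P\<^esub> g)"
proof -
  have "congruent2 (ultra_rel I U G) (ultra_rel I U G) (\<lambda>f g. cls (f \<otimes>\<^bsub>P\<^esub> g))"
  proof (rule congruent2I')
    fix f f' g g'
    assume "(f, f') \<in> ultra_rel I U G" "(g, g') \<in> ultra_rel I U G"
    then have c: "f \<in> carrier P" "f' \<in> carrier P" "g \<in> carrier P" "g' \<in> carrier P"
      and e: "eventually (\<lambda>i. f i = f' i) U" "eventually (\<lambda>i. g i = g' i) U"
      by (auto simp: ultra_rel_def)
    have "eventually (\<lambda>i. (f \<otimes>\<^bsub>P\<^esub> g) i = (f' \<otimes>\<^bsub>P\<^esub> g') i) U"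
      using e eventually_mem by eventually_elim simp
    with c show "cls (f \<otimes>\<^bsub>P\<^esub> g) = cls (f' \<otimes>\<^bsub>P\<^esub> g')"
      by (simp only: cls_eq_iff P.m_closed)
  qed
  then show ?thesis
    using assms UN_equiv_class2[OF equiv_ultra_rel equiv_ultra_rel, of _ f g]
    by (simp add: ultraproduct_def)
qed

lemma carrier_ultraproduct: "carrier (ultraproduct I U G) = cls ` carrier P"
  by (auto simp: ultraproduct_def quotient_def)

lemma one_ultraproduct: "\<one>\<^bsub>ultraproduct I U G\<^esub> = cls \<one>\<^bsub>P\<^esub>"
  by (simp add: ultraproduct_def)

lemma cls_hom: "cls \<in> hom P (ultraproduct I U G)"
  by (auto simp: hom_def carrier_ultraproduct mult_cls simp del: carrier_product_group)

text \<open>The ultraproduct is the image of the group \<open>P\<close> under the homomorphism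
  \<open>cls\<close>.\<close>

lemma group_ultraproduct: "group (ultraproduct I U G)"
proof -
  \<comment> \<open>The image group is stated as a record with updated carrier and unit; both
    updates restore the values already present.\<close>
  have "ultraproduct I U G\<lparr>carrier := cls ` carrier P, one := cls \<one>\<^bsub>P\<^esub>\<rparr> = ultraproduct I U G"
    unfolding carrier_ultraproduct[symmetric] one_ultraproduct[symmetric] by simp
  then show ?thesis
    using P.hom_imp_img_group[OF cls_hom] by simp
qed

lemma inv_cls: "f \<in> carrier P \<Longrightarrow> inv\<^bsub>ultraproduct I U G\<^esub> (cls f) = cls (inv\<^bsub>P\<^esub> f)"
  using group_hom.hom_inv[of P "ultraproduct I U G" cls f] cls_hom group_ultraproduct P.is_group
  by (simp add: group_hom_def group_hom_axioms_def)

section \<open>Transfer of the axioms through almost all coordinates\<close>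

lemma nth_mem: "f \<in> carrier P \<Longrightarrow> i \<in> I \<Longrightarrow> f i \<in> carrier (G i)"
  by auto

text \<open>This is the case of Los's theorem for a negated equation: the ultrafilter property moves
  the negation inside \<open>eventually\<close>.\<close>

lemma cls_ne_one_iff:
  assumes "f \<in> carrier P"
  shows "cls f \<noteq> \<one>\<^bsub>ultraproduct I U G\<^esub> \<longleftrightarrow> eventually (\<lambda>i. f i \<noteq> \<one>\<^bsub>G i\<^esub>) U"
proof -
  have "eventually (\<lambda>i. f i = \<one>\<^bsub>P\<^esub> i) U \<longleftrightarrow> eventually (\<lambda>i. f i = \<one>\<^bsub>G i\<^esub>) U"
    using eventually_mem by (rule eventually_subst[OF eventually_mono]) simp
  then show ?thesis
    unfolding one_ultraproduct cls_eq_iff[OF assms P.one_closed] eventually_not_iff by simp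
qed

text \<open>Los's theorem for a commutation equation: both products are formed on representatives
  and compared coordinatewise on \<open>I\<close>.\<close>

lemma cls_commute_iff:
  assumes "f \<in> carrier P" "g \<in> carrier P"
  shows "cls f \<otimes>\<^bsub>ultraproduct I U G\<^esub> cls g = cls g \<otimes>\<^bsub>ultraproduct I U G\<^esub> cls f \<longleftrightarrow>
    eventually (\<lambda>i. f i \<otimes>\<^bsub>G i\<^esub> g i = g i \<otimes>\<^bsub>G i\<^esub> f i) U"
proof -
  have "eventually (\<lambda>i. (f \<otimes>\<^bsub>P\<^esub> g) i = (g \<otimes>\<^bsub>P\<^esub> f) i) U \<longleftrightarrow>
    eventually (\<lambda>i. f i \<otimes>\<^bsub>G i\<^esub> g i = g i \<otimes>\<^bsub>G i\<^esub> f i) U"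
    using eventually_mem by (rule eventually_subst[OF eventually_mono]) simp
  then show ?thesis
    using assms by (simp add: mult_cls cls_eq_iff del: carrier_product_group mult_product_group)
qed

lemma commutation_transitive_ultraproduct:
  assumes "\<And>i. i \<in> I \<Longrightarrow> commutation_transitive (G i)"
  shows "commutation_transitive (ultraproduct I U G)"
  \<comment> \<open>Since the carrier is an image under \<open>cls\<close>, quantification over
    classes becomes quantification over representatives in \<open>P\<close>.\<close>
  unfolding commutation_transitive_def carrier_ultraproduct ball_simps
proof (intro ballI impI, elim conjE)
  fix f g h
  assume c: "f \<in> carrier P" "g \<in> carrier P" "h \<in> carrier P"
    and "cls g \<noteq> \<one>\<^bsub>ultraproduct I U G\<^esub>"
    and "cls f \<otimes>\<^bsub>ultraproduct I U G\<^esub> cls g = cls g \<otimes>\<^bsub>ultraproduct I U G\<^esub> cls f"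
    and "cls g \<otimes>\<^bsub>ultraproduct I U G\<^esub> cls h = cls h \<otimes>\<^bsub>ultraproduct I U G\<^esub> cls g"
  then have
    "eventually (\<lambda>i. g i \<noteq> \<one>\<^bsub>G i\<^esub>) U"
    "eventually (\<lambda>i. f i \<otimes>\<^bsub>G i\<^esub> g i = g i \<otimes>\<^bsub>G i\<^esub> f i) U"
    "eventually (\<lambda>i. g i \<otimes>\<^bsub>G i\<^esub> h i = h i \<otimes>\<^bsub>G i\<^esub> g i) U"
    by (simp_all only: cls_ne_one_iff cls_commute_iff)
  \<comment> \<open>The three premises and membership in \<open>I\<close> hold together for almost
    all \<open>i\<close>, and there the axiom of \<open>G i\<close> applies.\<close>
  then have "eventually (\<lambda>i. f i \<otimes>\<^bsub>G i\<^esub> h i = h i \<otimes>\<^bsub>G i\<^esub> f i) U"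
    using eventually_mem
  proof eventually_elim
    case (elim i)
    with assms[of i] nth_mem[OF c(1)] nth_mem[OF c(2)] nth_mem[OF c(3)] show ?case
      unfolding commutation_transitive_def by blast
  qed
  with c show "cls f \<otimes>\<^bsub>ultraproduct I U G\<^esub> cls h = cls h \<otimes>\<^bsub>ultraproduct I U G\<^esub> cls f"
    by (simp only: cls_commute_iff)
qed

lemma conjugate_commutation_ultraproduct:
  assumes "\<And>i. i \<in> I \<Longrightarrow> conjugate_commutation (G i)"
  shows "conjugate_commutation (ultraproduct I U G)"
  unfolding conjugate_commutation_def carrier_ultraproduct ball_simps
proof (intro ballI impI, elim conjE)
  fix f g
  let ?k = "inv\<^bsub>P\<^esub> g \<otimes>\<^bsub>P\<^esub> f \<otimes>\<^bsub>P\<^esub> g"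
  let ?K = "inv\<^bsub>ultraproduct I U G\<^esub> (cls g) \<otimes>\<^bsub>ultraproduct I U G\<^esub> cls f
    \<otimes>\<^bsub>ultraproduct I U G\<^esub> cls g"
  assume c: "f \<in> carrier P" "g \<in> carrier P"
    and ne: "cls f \<noteq> \<one>\<^bsub>ultraproduct I U G\<^esub>"
    and comm: "cls f \<otimes>\<^bsub>ultraproduct I U G\<^esub> ?K = ?K \<otimes>\<^bsub>ultraproduct I U G\<^esub> cls f"
  have k: "?k \<in> carrier P"
    using c by (intro P.m_closed P.inv_closed)
  \<comment> \<open>Conjugation can be done on representatives, so the premise becomes a commutation
    of two classes of elements of \<open>P\<close>.\<close>
  have "?K = cls ?k"
    using c by (simp only: inv_cls mult_cls P.m_closed P.inv_closed)
  with comm have "eventually (\<lambda>i. f i \<otimes>\<^bsub>G i\<^esub> ?k i = ?k i \<otimes>\<^bsub>G i\<^esub> f i) U"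
    using cls_commute_iff[OF c(1) k] by simp
  moreover have "eventually (\<lambda>i. f i \<noteq> \<one>\<^bsub>G i\<^esub>) U"
    using ne c by (simp only: cls_ne_one_iff)
  ultimately have "eventually (\<lambda>i. f i \<otimes>\<^bsub>G i\<^esub> g i = g i \<otimes>\<^bsub>G i\<^esub> f i) U"
    using eventually_mem
  proof eventually_elim
    case (elim i)
    \<comment> \<open>For \<open>i\<close> in \<open>I\<close> the inverse in the product is taken
      coordinatewise, so \<open>?k i\<close> is the conjugate to which the axiom of
      \<open>G i\<close> refers.\<close>
    have "?k i = inv\<^bsub>G i\<^esub> g i \<otimes>\<^bsub>G i\<^esub> f i \<otimes>\<^bsub>G i\<^esub> g i"
      using elim(3) c groups by (simp add: inv_product_group)
    with elim assms[of i] nth_mem[OF c(1)] nth_mem[OF c(2)] show ?case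
      unfolding conjugate_commutation_def by metis
  qed
  with c show "cls f \<otimes>\<^bsub>ultraproduct I U G\<^esub> cls g = cls g \<otimes>\<^bsub>ultraproduct I U G\<^esub> cls f"
    by (simp only: cls_commute_iff)
qed

end

lemma csa_group_ultraproduct:
  assumes "ultrafilter_on I U" and "\<And>i. i \<in> I \<Longrightarrow> csa_group (G i)"
  shows "csa_group (ultraproduct I U G)"
proof -
  interpret group_ultraproduct I U G
    using assms by (simp add: group_ultraproduct.intro csa_group_iff)
  show ?thesis
    using assms group_ultraproduct commutation_transitive_ultraproduct
      conjugate_commutation_ultraproduct by (simp add: csa_group_iff)
qed

theorem proposition10:
  shows "(finite csa_axioms \<and>
          (\<forall>p \<in> csa_axioms. universal_sentence p) \<and>
          (\<forall>G :: ('a, 'm) monoid_scheme.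
             csa_group G \<longleftrightarrow> group G \<and> (\<forall>p \<in> csa_axioms. models G p))) \<and>
         (\<forall>(I :: 'i set) U (G :: 'i \<Rightarrow> ('a, 'm) monoid_scheme).
            ultrafilter_on I U \<longrightarrow> (\<forall>i \<in> I. csa_group (G i)) \<longrightarrow>
            csa_group (ultraproduct I U G)) \<and>
         (\<forall>(G :: ('a, 'm) monoid_scheme) H.
            csa_group G \<longrightarrow> subgroup H G \<longrightarrow> csa_group (G\<lparr>carrier := H\<rparr>))"
proof (intro conjI allI impI ballI)
  show "finite csa_axioms"
    by (simp add: csa_axioms_def)
  show "universal_sentence p" if "p \<in> csa_axioms" for p
    using that by (rule universal_sentence_csa_axioms)
  show "csa_group G \<longleftrightarrow> group G \<and> (\<forall>p \<in> csa_axioms. models G p)"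
    for G :: "('a, 'm) monoid_scheme"
    using csa_group_iff models_csa_axioms_iff by blast
  show "csa_group (ultraproduct I U G)"
    if "ultrafilter_on I U" "\<forall>i \<in> I. csa_group (G i)"
    for I :: "'i set" and U and G :: "'i \<Rightarrow> ('a, 'm) monoid_scheme"
    using that csa_group_ultraproduct by blast
  show "csa_group (G\<lparr>carrier := H\<rparr>)" if "csa_group G" "subgroup H G"
    for G :: "('a, 'm) monoid_scheme" and H
    using that by (rule csa_group_subgroup)
qed

end
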